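(* Let $[\underline F,\overline F]$ be a p-box on $\mathbb R$. If the function $h:\mathbb R\to\mathbb R$ has one maximum at point $a\in\mathbb R$ (i.e. $h$ is increasing on $(-\infty,a]$ and decreasing on $[a,\infty)$), then the upper and lower expectations of $h(X)$ on $[\underline F,\overline F]$ are $$\overline{\mathbb E}(h)=\int_{-\infty}^a h(x)\,\mathrm d\underline F+h(a)\bigl[\overline F(a)-\underline F(a)\bigr]+\int_a^\infty h(x)\,\mathrm d\overline F,$$ $$\underline{\mathbb E}(h)=\int_{-\infty}^{\overline F^{-1}(\alpha)}h(x)\,\mathrm d\overline F+\int_{\underline F^{-1}(\alpha)}^{\infty}h(x)\,\mathrm d\underline F,$$ or, equivalently, $$\overline{\mathbb E}(h)=\int_0^{\underline F(a)}h(a^\ast_\gamma)\,\mathrm d\gamma+\bigl[\overline F(a)-\underline F(a)\bigr]h(a)+\int_{\overline F(a)}^1 h(a_{\ast\gamma})\,\mathrm d\gamma,$$ $$\underline{\mathbb E}(h)=\int_0^\alpha h(a_{\ast\gamma})\,\mathrm d\gamma+\int_\alpha^1 h(a^\ast_\gamma)\,\mathrm d\gamma,$$ where $\alpha$ is the solution of the equation $$h\bigl(\overline F^{-1}(\alpha)\bigr)=h\bigl(\underline F^{-1}(\alpha)\bigr)$$ such that $\alpha\in[\underline F(a),\overline F(a)]$.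
   Context: A p-box $[\underline F,\overline F]$ is a pair consisting of a lower and an upper cumulative probability distribution on $\mathbb R$, with $\underline F\le\overline F$ pointwise, describing the uncertainty about a real-valued random variable $X$. It represents the set of all cumulative distributions $F$ with $\underline F(x)\le F(x)\le\overline F(x)$ for all $x\in\mathbb R$. It is assumed throughout that either the probabilities considered are $\sigma$-additive or $h$ is continuous. The lower and upper expectations of $h$ on the p-box are $$\underline{\mathbb E}(h)=\inf_{\underline F\le F\le\overline F}\int_{\mathbb R}h(x)\,\mathrm dF,\qquad \overline{\mathbb E}(h)=\sup_{\underline F\le F\le\overline F}\int_{\mathbb R}h(x)\,\mathrm dF,$$ where $F$ ranges over all cumulative distributions in the p-box. For $\gamma\in[0,1]$, $a_{\ast\gamma}=\overline F^{-1}(\gamma):=\sup\{x\in\mathbb R:\overline F(x)<\gamma\}$ and $a^\ast_\gamma=\underline F^{-1}(\gamma):=\inf\{x\in\mathbb R:\underline F(x)>\gamma\}$.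
   Formalization: In the second formula, which fails literally for p-boxes with jumps, mass at the endpoint quantiles is split so that the two integrals carry masses α and 1−α; the lower formulas are stated for every solution α in the interval, whose existence is not asserted. *)

theory Defs
  imports "HOL-Probability.Probability"
begin

section \<open>Cumulative distributions and p-boxes\<close>

definition cdfs :: "(real \<Rightarrow> real) set" where
  "cdfs = {F. mono F \<and> (F \<longlongrightarrow> 0) at_bot \<and> (F \<longlongrightarrow> 1) at_top}"

text \<open>A finitely additive probability may induce any member of \<^const>\<open>cdfs\<close>; the
  \<open>\<sigma>\<close>-additive ones induce exactly the right-continuous members.\<close>

definition sigma_additive_cdfs :: "(real \<Rightarrow> real) set" where
  "sigma_additive_cdfs = {F \<in> cdfs. \<forall>x. continuous (at_right x) F}"

definition pbox :: "(real \<Rightarrow> real) set \<Rightarrow> (real \<Rightarrow> real) \<Rightarrow> (real \<Rightarrow> real) \<Rightarrow> (real \<Rightarrow> real) set" where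
  "pbox \<D> Flo Fup = {F \<in> \<D>. \<forall>x. Flo x \<le> F x \<and> F x \<le> Fup x}"


section \<open>Integration against a cumulative distribution\<close>

text \<open>Integral with values in the extended reals. It is used only for integrands that are
  bounded above on sets of finite measure; the positive part then has a finite integral, so the
  difference never has the form \<open>\<infinity> - \<infinity>\<close>, and the value \<open>-\<infinity>\<close> is kept (the Bochner integral
  would return \<open>0\<close>).\<close>

definition ext_integral :: "'a measure \<Rightarrow> 'a set \<Rightarrow> ('a \<Rightarrow> ereal) \<Rightarrow> ereal" where
  "ext_integral M A f =
     enn2ereal (\<integral>\<^sup>+x\<in>A. e2ennreal (f x) \<partial>M) - enn2ereal (\<integral>\<^sup>+x\<in>A. e2ennreal (- f x) \<partial>M)"

text \<open>\<^const>\<open>interval_measure\<close> needs a right-continuous function. Passing to right limits changes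
  nothing for \<open>\<sigma>\<close>-additive \<open>F\<close>; for other \<open>F\<close> it leaves the Riemann--Stieltjes integral over the
  whole line of a continuous integrand unchanged.\<close>

definition stieltjes :: "(real \<Rightarrow> real) \<Rightarrow> real measure" where
  "stieltjes F = interval_measure (\<lambda>x. Lim (at_right x) F)"

definition expect :: "(real \<Rightarrow> real) \<Rightarrow> (real \<Rightarrow> real) \<Rightarrow> ereal" where
  "expect F h = ext_integral (stieltjes F) UNIV (\<lambda>x. ereal (h x))"

definition lower_expect ::
  "(real \<Rightarrow> real) set \<Rightarrow> (real \<Rightarrow> real) \<Rightarrow> (real \<Rightarrow> real) \<Rightarrow> (real \<Rightarrow> real) \<Rightarrow> ereal" where
  "lower_expect \<D> Flo Fup h = (INF F\<in>pbox \<D> Flo Fup. expect F h)"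

definition upper_expect ::
  "(real \<Rightarrow> real) set \<Rightarrow> (real \<Rightarrow> real) \<Rightarrow> (real \<Rightarrow> real) \<Rightarrow> (real \<Rightarrow> real) \<Rightarrow> ereal" where
  "upper_expect \<D> Flo Fup h = (SUP F\<in>pbox \<D> Flo Fup. expect F h)"


section \<open>Quantiles\<close>

text \<open>Extended-real valued: \<open>sup_quantile F 0 = -\<infinity>\<close> and \<open>inf_quantile F 1 = \<infinity>\<close> always. The first is
  applied to the upper, the second to the lower distribution of a p-box.\<close>

definition sup_quantile :: "(real \<Rightarrow> real) \<Rightarrow> real \<Rightarrow> ereal" where
  "sup_quantile F \<gamma> = (SUP x\<in>{x. F x < \<gamma>}. ereal x)"

definition inf_quantile :: "(real \<Rightarrow> real) \<Rightarrow> real \<Rightarrow> ereal" where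
  "inf_quantile F \<gamma> = (INF x\<in>{x. F x > \<gamma>}. ereal x)"

text \<open>The limits exist when \<open>h\<close> is monotone near \<open>\<plusminus>\<infinity>\<close>.\<close>

definition at_ext :: "(real \<Rightarrow> real) \<Rightarrow> ereal \<Rightarrow> ereal" where
  "at_ext h q =
     (case q of
        ereal x \<Rightarrow> ereal (h x)
      | PInfty \<Rightarrow> Lim at_top (\<lambda>x. ereal (h x))
      | MInfty \<Rightarrow> Lim at_bot (\<lambda>x. ereal (h x)))"


section \<open>Stieltjes integrals up to and from a point\<close>

text \<open>\<open>\<integral>\<^bsub>-\<infinity>\<^esub>\<^bsup>q\<^esup> h dF\<close> and \<open>\<integral>\<^bsub>q\<^esub>\<^bsup>\<infinity>\<^esup> h dF\<close>, where the point \<open>q\<close> has \<open>F\<close>-level \<open>c\<close>: an atom at \<open>q\<close> is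
  split so that the first integral carries total mass \<open>c\<close> and the second \<open>1 - c\<close>. For \<open>c = F q\<close>
  and \<open>F\<close> right-continuous these are the integrals over \<open>{..q}\<close> and \<open>{q<..}\<close> (lemmas below); for
  \<open>c = F q\<close> and \<open>h\<close> continuous they are the improper Riemann--Stieltjes integrals.
  If \<open>q\<close> is a quantile at level \<open>\<alpha>\<close> of a discontinuous \<open>F\<close>, then \<open>F q\<close> may differ from \<open>\<alpha>\<close>, and
  \<open>c = \<alpha>\<close> is the level for which the two pieces of a lower expectation have total mass \<open>1\<close>.\<close>

definition integral_upto ::
  "(real \<Rightarrow> real) \<Rightarrow> (real \<Rightarrow> real) \<Rightarrow> ereal \<Rightarrow> real \<Rightarrow> ereal" where
  "integral_upto F h q c =
     ext_integral (stieltjes F) {x. ereal x < q} (\<lambda>x. ereal (h x))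
     + at_ext h q * ereal (c - measure (stieltjes F) {x. ereal x < q})"

definition integral_from ::
  "(real \<Rightarrow> real) \<Rightarrow> (real \<Rightarrow> real) \<Rightarrow> ereal \<Rightarrow> real \<Rightarrow> ereal" where
  "integral_from F h q c =
     ext_integral (stieltjes F) {x. q < ereal x} (\<lambda>x. ereal (h x))
     + at_ext h q * ereal ((1 - c) - measure (stieltjes F) {x. q < ereal x})"


section \<open>Consistency with the standard notions\<close>

lemma stieltjes_sigma_additive:
  assumes "F \<in> sigma_additive_cdfs"
  shows "stieltjes F = interval_measure F"
proof -
  have "(F \<longlongrightarrow> F x) (at_right x)" for x
    using assms by (auto simp: sigma_additive_cdfs_def continuous_within)
  then have "Lim (at_right x) F = F x" for x
    by (intro tendsto_Lim) auto
  then show ?thesis by (simp add: stieltjes_def)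
qed

lemma ext_integral_eq_set_lebesgue_integral:
  assumes "set_integrable M A f"
  shows "ext_integral M A (\<lambda>x. ereal (f x)) = ereal (set_lebesgue_integral M A f)"
proof -
  let ?g = "\<lambda>x. indicator A x *\<^sub>R f x"
  have g: "integrable M ?g" using assms by (simp add: set_integrable_def)
  have p: "(\<integral>\<^sup>+x\<in>A. e2ennreal (ereal (f x)) \<partial>M) = (\<integral>\<^sup>+x. ennreal (?g x) \<partial>M)"
    by (intro nn_integral_cong) (auto simp: indicator_def)
  have n: "(\<integral>\<^sup>+x\<in>A. e2ennreal (- ereal (f x)) \<partial>M) = (\<integral>\<^sup>+x. ennreal (- ?g x) \<partial>M)"
    by (intro nn_integral_cong) (auto simp: indicator_def)
  have fin: "(\<integral>\<^sup>+x. ennreal (?g x) \<partial>M) \<noteq> top" "(\<integral>\<^sup>+x. ennreal (- ?g x) \<partial>M) \<noteq> top"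
    using g by (auto simp: real_integrable_def)
  obtain u where "u \<ge> 0" "(\<integral>\<^sup>+x. ennreal (?g x) \<partial>M) = ennreal u"
    using fin(1) by (cases "\<integral>\<^sup>+x. ennreal (?g x) \<partial>M" rule: ennreal_cases) auto
  moreover obtain v where "v \<ge> 0" "(\<integral>\<^sup>+x. ennreal (- ?g x) \<partial>M) = ennreal v"
    using fin(2) by (cases "\<integral>\<^sup>+x. ennreal (- ?g x) \<partial>M" rule: ennreal_cases) auto
  ultimately show ?thesis
    unfolding ext_integral_def p n set_lebesgue_integral_def real_lebesgue_integral_def[OF g]
    by (simp add: enn2ereal_ennreal)
qed

lemma nn_set_integral_insert_atom:
  fixes q :: real
  assumes "sets M = sets borel" "A \<in> sets borel" "q \<notin> A"
    and "f \<in> borel_measurable borel"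
  shows "(\<integral>\<^sup>+x\<in>insert q A. f x \<partial>M) = (\<integral>\<^sup>+x\<in>A. f x \<partial>M) + f q * emeasure M {q}"
proof -
  have [measurable_cong]: "sets M = sets borel" by fact
  note assms(2,4)[measurable]
  have "(\<integral>\<^sup>+x\<in>insert q A. f x \<partial>M) = (\<integral>\<^sup>+x. f x * indicator A x + f q * indicator {q} x \<partial>M)"
    using \<open>q \<notin> A\<close> by (intro nn_integral_cong) (auto simp: indicator_def)
  also have "\<dots> = (\<integral>\<^sup>+x\<in>A. f x \<partial>M) + f q * emeasure M {q}"
    by (subst nn_integral_add) (auto simp: nn_integral_cmult_indicator assms(1))
  finally show ?thesis .
qed

lemma ext_integral_insert_atom:
  fixes q :: real
  assumes "finite_measure M" "sets M = sets borel" "A \<in> sets borel" "q \<notin> A"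
    and [measurable]: "h \<in> borel_measurable borel"
  shows "ext_integral M (insert q A) (\<lambda>x. ereal (h x)) =
    ext_integral M A (\<lambda>x. ereal (h x)) + ereal (h q * measure M {q})"
proof -
  interpret finite_measure M by fact
  have 1: "(\<integral>\<^sup>+x\<in>insert q A. ennreal (h x) \<partial>M)
      = (\<integral>\<^sup>+x\<in>A. ennreal (h x) \<partial>M) + ennreal (max 0 (h q) * measure M {q})"
    by (subst nn_set_integral_insert_atom[OF assms(2-4)])
       (auto simp: emeasure_eq_measure ennreal_mult' max_def ennreal_neg)
  have 2: "(\<integral>\<^sup>+x\<in>insert q A. ennreal (- h x) \<partial>M)
      = (\<integral>\<^sup>+x\<in>A. ennreal (- h x) \<partial>M) + ennreal (max 0 (- h q) * measure M {q})"
    by (subst nn_set_integral_insert_atom[OF assms(2-4)])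
       (auto simp: emeasure_eq_measure ennreal_mult' max_def ennreal_neg)
  have 3: "max 0 (h q) * m - max 0 (- h q) * m = h q * m" for m
    by (auto simp: max_def)
  have 4: "(a + ereal s) - (b + ereal t) = (a - b) + ereal (s - t)" for a b s t
    by (cases a; cases b) auto
  show ?thesis
    unfolding ext_integral_def
    by (simp add: 1 2 plus_ennreal.rep_eq enn2ereal_ennreal 3 4)
qed

lemma
  assumes F: "F \<in> sigma_additive_cdfs" and h: "h \<in> borel_measurable borel"
  shows integral_upto_eq:
      "integral_upto F h (ereal q) (F q) =
        ext_integral (interval_measure F) {..q} (\<lambda>x. ereal (h x))"
    and integral_from_eq:
      "integral_from F h (ereal q) (F q) =
        ext_integral (interval_measure F) {q<..} (\<lambda>x. ereal (h x))"
proof -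
  let ?M = "interval_measure F"
  have F': "mono F" "\<And>x. continuous (at_right x) F" "(F \<longlongrightarrow> 0) at_bot" "(F \<longlongrightarrow> 1) at_top"
    using F by (auto simp: sigma_additive_cdfs_def cdfs_def)
  interpret real_distribution ?M
    by (rule real_distribution_interval_measure) (use F' in \<open>auto dest: monoD\<close>)
  have Iic: "measure ?M {..q} = F q"
    by (rule measure_interval_measure_Iic) (use F' in \<open>auto dest: monoD\<close>)
  have "measure ?M {..q} = measure ?M {..<q} + measure ?M {q}"
    by (subst finite_measure_Union[symmetric]) (auto intro!: arg_cong[of _ _ "measure ?M"])
  then have atom: "measure ?M {q} = F q - measure ?M {..<q}"
    using Iic by simp
  have "measure ?M {q<..} = 1 - F q"
    using prob_compl[of "{..q}"] Iic by (simp add: Compl_eq_Diff_UNIV[symmetric])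
  then have up: "1 - F q - measure ?M {q<..} = 0" by simp
  have eq: "{..q} = insert q {..<q}" "{x. ereal x < ereal q} = {..<q}" 
    "{x. ereal q < ereal x} = {q<..}"
    by auto
  show "integral_upto F h (ereal q) (F q) = ext_integral ?M {..q} (\<lambda>x. ereal (h x))"
    unfolding integral_upto_def stieltjes_sigma_additive[OF F] eq
    by (subst ext_integral_insert_atom) (auto simp: h atom at_ext_def finite_measure_axioms)
  show "integral_from F h (ereal q) (F q) = ext_integral ?M {q<..} (\<lambda>x. ereal (h x))"
    unfolding integral_from_def stieltjes_sigma_additive[OF F] eq up by (simp add: zero_ereal_def[symmetric])
qed

end

theory Submission
  imports Defs
begin

text \<open>If \<open>U\<close> is uniform on \<open>(0, 1)\<close>, then the quantile function of \<open>F\<close> at \<open>U\<close> has distribution \<open>F\<close>, so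
  the expectation of \<open>h\<close> is the integral of \<open>h\<close> along the quantiles of \<open>F\<close>. For \<open>F\<close> in the p-box, the
  quantile at level \<open>\<gamma>\<close> lies between those of \<open>Fup\<close> and \<open>Flo\<close>. Level by level, a unimodal \<open>h\<close> is
  maximal at the point of this interval nearest to \<open>a\<close> and minimal at one of its ends: at the left
  end for \<open>\<gamma> < \<alpha>\<close> and at the right end for \<open>\<gamma> > \<alpha>\<close>. Both selections are the quantile functions of
  members of the p-box, so the bounds are attained.\<close>

section \<open>Extended integrals\<close>

lemma ext_integral_cong_AE:
  assumes "AE x in M. (x \<in> A \<longleftrightarrow> x \<in> B) \<and> (x \<in> A \<longrightarrow> f x = g x)"
  shows "ext_integral M A f = ext_integral M B g"
proof -
  have "(\<integral>\<^sup>+x\<in>A. e2ennreal (f x) \<partial>M) = (\<integral>\<^sup>+x\<in>B. e2ennreal (g x) \<partial>M)"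
    by (intro nn_integral_cong_AE, rule eventually_mono[OF assms]) (auto simp: indicator_def)
  moreover have "(\<integral>\<^sup>+x\<in>A. e2ennreal (- f x) \<partial>M) = (\<integral>\<^sup>+x\<in>B. e2ennreal (- g x) \<partial>M)"
    by (intro nn_integral_cong_AE, rule eventually_mono[OF assms]) (auto simp: indicator_def)
  ultimately show ?thesis by (simp add: ext_integral_def)
qed

text \<open>A larger integrand has a larger positive and a smaller negative part, and subtraction in
  \<open>ereal\<close> respects this even at infinite values.\<close>

lemma ext_integral_mono_AE:
  assumes "AE x in M. x \<in> A \<longrightarrow> f x \<le> g x"
  shows "ext_integral M A f \<le> ext_integral M A g"
  unfolding ext_integral_def
proof (rule ereal_minus_mono)
  show "enn2ereal (\<integral>\<^sup>+x\<in>A. e2ennreal (f x) \<partial>M) \<le> enn2ereal (\<integral>\<^sup>+x\<in>A. e2ennreal (g x) \<partial>M)"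
    unfolding less_eq_ennreal.rep_eq[symmetric] using assms
    by (intro nn_integral_mono_AE) (auto elim!: eventually_mono simp: indicator_def intro!: e2ennreal_mono)
  show "enn2ereal (\<integral>\<^sup>+x\<in>A. e2ennreal (- g x) \<partial>M) \<le> enn2ereal (\<integral>\<^sup>+x\<in>A. e2ennreal (- f x) \<partial>M)"
    unfolding less_eq_ennreal.rep_eq[symmetric] using assms
    by (intro nn_integral_mono_AE) (auto elim!: eventually_mono simp: indicator_def intro!: e2ennreal_mono)
qed

text \<open>The upper bound on a set of finite measure makes both positive integrals finite. Only
  the negative integrals can be infinite, and then both sides are -\<infinity>.\<close>

lemma ext_integral_Un:
  fixes f :: "'a \<Rightarrow> real"
  assumes [measurable]: "A \<in> sets M" "B \<in> sets M" "f \<in> borel_measurable M"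
    and disj: "A \<inter> B = {}" and fin: "emeasure M (A \<union> B) < \<infinity>"
    and bound: "\<And>x. x \<in> A \<union> B \<Longrightarrow> f x \<le> c"
  shows "ext_integral M (A \<union> B) (\<lambda>x. ereal (f x)) =
    ext_integral M A (\<lambda>x. ereal (f x)) + ext_integral M B (\<lambda>x. ereal (f x))"
proof -
  have split: "(\<integral>\<^sup>+x\<in>A \<union> B. g x \<partial>M) = (\<integral>\<^sup>+x\<in>A. g x \<partial>M) + (\<integral>\<^sup>+x\<in>B. g x \<partial>M)"
    if [measurable]: "g \<in> borel_measurable M" for g :: "'a \<Rightarrow> ennreal"
  proof -
    have "(\<integral>\<^sup>+x\<in>A \<union> B. g x \<partial>M) = (\<integral>\<^sup>+x. g x * indicator A x + g x * indicator B x \<partial>M)"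
      using disj by (intro nn_integral_cong) (auto simp: indicator_def)
    also have "\<dots> = (\<integral>\<^sup>+x\<in>A. g x \<partial>M) + (\<integral>\<^sup>+x\<in>B. g x \<partial>M)"
      by (rule nn_integral_add) auto
    finally show ?thesis .
  qed
  have pos: "(\<integral>\<^sup>+x\<in>A \<union> B. ennreal (f x) \<partial>M) < \<infinity>"
  proof -
    have "(\<integral>\<^sup>+x\<in>A \<union> B. ennreal (f x) \<partial>M) \<le> (\<integral>\<^sup>+x. ennreal c * indicator (A \<union> B) x \<partial>M)"
      using bound by (intro nn_integral_mono) (auto simp: indicator_def intro!: ennreal_leI)
    also have "\<dots> < \<infinity>"
      using fin by (subst nn_integral_cmult_indicator) (auto simp: ennreal_mult_less_top)
    finally show ?thesis .
  qed
  then have "(\<integral>\<^sup>+x\<in>A. ennreal (f x) \<partial>M) \<noteq> top" "(\<integral>\<^sup>+x\<in>B. ennreal (f x) \<partial>M) \<noteq> top"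
    by (auto simp: split)
  then obtain u v where uv: "u \<ge> 0" "v \<ge> 0" "(\<integral>\<^sup>+x\<in>A. ennreal (f x) \<partial>M) = ennreal u"
      "(\<integral>\<^sup>+x\<in>B. ennreal (f x) \<partial>M) = ennreal v"
    by (cases "\<integral>\<^sup>+x\<in>A. ennreal (f x) \<partial>M" rule: ennreal_cases;
        cases "\<integral>\<^sup>+x\<in>B. ennreal (f x) \<partial>M" rule: ennreal_cases) auto
  \<comment> \<open>Regrouping is sound here because \<open>u\<close> and \<open>v\<close> are real
    and \<open>p\<close>, \<open>q\<close> cannot be -\<infinity>, so no difference of infinities
    arises.\<close>
  have alg: "ereal (u + v) - (p + q) = (ereal u - p) + (ereal v - q)"
    if "p \<ge> 0" "q \<ge> 0" for p q
    using that by (cases p; cases q) auto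
  show ?thesis
    unfolding ext_integral_def
    by (simp add: split uv plus_ennreal.rep_eq enn2ereal_ennreal alg enn2ereal_nonneg)
qed

lemma ext_integral_const:
  assumes "A \<in> sets M" "emeasure M A < \<infinity>"
  shows "ext_integral M A (\<lambda>_. ereal c) = ereal (c * measure M A)"
proof -
  have m: "emeasure M A = ennreal (measure M A)"
    using assms by (simp add: emeasure_eq_ennreal_measure less_top)
  \<comment> \<open>\<open>ennreal\<close> truncates negative reals to 0, hence
    \<open>max 0 d\<close>; with \<open>d = c\<close> and \<open>d = - c\<close> this covers both
    parts of the integral.\<close>
  have e: "(\<integral>\<^sup>+x\<in>A. ennreal d \<partial>M) = ennreal (max 0 d * measure M A)" for d
    using assms(1)
    by (auto simp: nn_integral_cmult_indicator m ennreal_mult''[symmetric] max_def ennreal_neg mult_nonpos_nonneg)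
  have "max 0 c * r - max 0 (- c) * r = c * r" for r
    by (auto simp: max_def)
  then show ?thesis
    unfolding ext_integral_def by (simp add: e enn2ereal_ennreal)
qed


section \<open>Quantiles\<close>

text \<open>A real-valued version, so that \<open>h\<close> can be composed with it. For members of
  \<open>cdfs\<close> the value of \<open>sup_quantile\<close> is finite at levels in (0, 1); the
  default 0 of \<open>real_of_ereal\<close> matters only outside.\<close>

definition quantile :: "(real \<Rightarrow> real) \<Rightarrow> real \<Rightarrow> real" where
  "quantile F \<gamma> = real_of_ereal (sup_quantile F \<gamma>)"

lemma cdf_bounds:
  assumes "F \<in> cdfs"
  shows "0 \<le> F x" "F x \<le> 1"
proof -
  have F: "mono F" "(F \<longlongrightarrow> 0) at_bot" "(F \<longlongrightarrow> 1) at_top"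
    using assms by (auto simp: cdfs_def)
  show "0 \<le> F x"
    using F(1) by (intro tendsto_upperbound[OF F(2)])
      (auto simp: eventually_at_bot_linorder mono_def intro!: exI[of _ x])
  show "F x \<le> 1"
    using F(1) by (intro tendsto_lowerbound[OF F(3)])
      (auto simp: eventually_at_top_linorder mono_def intro!: exI[of _ x])
qed

lemma ex_cdf_less:
  assumes "F \<in> cdfs" "0 < \<gamma>"
  shows "\<exists>x. F x < \<gamma>"
proof -
  have "eventually (\<lambda>x. F x < \<gamma>) at_bot"
    using assms by (intro order_tendstoD(2)[of F 0]) (auto simp: cdfs_def)
  then show ?thesis by (auto dest: eventually_happens)
qed

lemma ex_cdf_greater:
  assumes "F \<in> cdfs" "\<gamma> < 1"
  shows "\<exists>x. \<gamma> < F x"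
proof -
  have "eventually (\<lambda>x. \<gamma> < F x) at_top"
    using assms by (intro order_tendstoD(1)[of F 1]) (auto simp: cdfs_def)
  then show ?thesis by (auto dest: eventually_happens)
qed

lemma sup_quantile_mono: "\<gamma> \<le> \<delta> \<Longrightarrow> sup_quantile F \<gamma> \<le> sup_quantile F \<delta>"
  unfolding sup_quantile_def by (rule SUP_subset_mono) auto

lemma inf_quantile_mono: "\<gamma> \<le> \<delta> \<Longrightarrow> inf_quantile F \<gamma> \<le> inf_quantile F \<delta>"
  unfolding inf_quantile_def by (rule INF_superset_mono) auto

text \<open>Larger distributions have fewer points below a level. The order of a p-box is therefore
  reversed on quantiles: those of the upper distribution lie furthest left.\<close>

lemma sup_quantile_antimono:
  assumes "\<And>x. F x \<le> G x"
  shows "sup_quantile G \<gamma> \<le> sup_quantile F \<gamma>"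
  unfolding sup_quantile_def by (rule SUP_subset_mono) (auto intro: order.strict_trans1[OF assms])

lemma sup_quantile_le_inf_quantile:
  assumes "mono F"
  shows "sup_quantile F \<gamma> \<le> inf_quantile F \<gamma>"
  unfolding sup_quantile_def inf_quantile_def
proof (intro SUP_least INF_greatest, clarify)
  fix x y assume "F x < \<gamma>" "\<gamma> < F y"
  then have "x < y" using monoD[OF assms, of y x] by (cases "x < y") auto
  then show "ereal x \<le> ereal y" by simp
qed

lemma sup_quantile_le_cdf: "mono F \<Longrightarrow> sup_quantile F (F x) \<le> ereal x"
  unfolding sup_quantile_def by (intro SUP_least) (auto elim: mono_invE)

lemma inf_quantile_ge_cdf: "mono F \<Longrightarrow> ereal x \<le> inf_quantile F (F x)"
  unfolding inf_quantile_def by (intro INF_greatest) (auto elim: mono_invE)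

text \<open>Finiteness: the limit 0 at -\<infinity> supplies a point below the level, the limit 1 at
  \<infinity> a point above it, and the supremum lies between the two.\<close>

lemma sup_quantile_eq_quantile:
  assumes F: "F \<in> cdfs" and \<gamma>: "0 < \<gamma>" "\<gamma> < 1"
  shows "sup_quantile F \<gamma> = ereal (quantile F \<gamma>)"
proof -
  obtain x where "F x < \<gamma>" using ex_cdf_less[OF F \<gamma>(1)] by auto
  then have 1: "ereal x \<le> sup_quantile F \<gamma>"
    unfolding sup_quantile_def by (intro SUP_upper) auto
  obtain y where y: "\<gamma> < F y" using ex_cdf_greater[OF F \<gamma>(2)] by auto
  have "sup_quantile F \<gamma> \<le> sup_quantile F (F y)"
    using y by (intro sup_quantile_mono) auto
  also have "\<dots> \<le> ereal y" using F by (intro sup_quantile_le_cdf) (auto simp: cdfs_def)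
  finally show ?thesis using 1
    by (cases "sup_quantile F \<gamma>") (auto simp: quantile_def)
qed

text \<open>The two quantiles can differ only at levels that \<open>F\<close> attains on a whole interval,
  hence at a rational point.\<close>

lemma inf_quantile_eq_quantile_AE:
  assumes F: "F \<in> cdfs"
  shows "AE \<gamma> in lborel. 0 < \<gamma> \<and> \<gamma> < 1 \<longrightarrow> inf_quantile F \<gamma> = ereal (quantile F \<gamma>)"
proof -
  have "mono F" using F by (auto simp: cdfs_def)
  have "countable (F ` \<rat>)" by (intro countable_image countable_rat)
  then have "AE \<gamma> in lborel. \<gamma> \<notin> F ` \<rat>"
    by (intro AE_not_in countable_imp_null_set_lborel)
  then show ?thesis
  proof (eventually_elim, intro impI)
    fix \<gamma> assume \<gamma>: "\<gamma> \<notin> F ` \<rat>" "0 < \<gamma> \<and> \<gamma> < 1"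
    have "inf_quantile F \<gamma> \<le> sup_quantile F \<gamma>"
    proof (rule ccontr)
      assume "\<not> ?thesis"
      then obtain x y where xy: "sup_quantile F \<gamma> < ereal x" "x < y" "ereal y < inf_quantile F \<gamma>"
        by (metis ereal_dense2 ereal_less_eq(3) less_ereal.simps(1) not_le)
      obtain r where r: "r \<in> \<rat>" "x < r" "r < y" using Rats_dense_in_real[OF \<open>x < y\<close>] by auto
      have "\<not> F r < \<gamma>"
      proof
        assume "F r < \<gamma>"
        then have "ereal r \<le> sup_quantile F \<gamma>" unfolding sup_quantile_def by (intro SUP_upper) auto
        then have "ereal r < ereal x" using xy(1) by (rule order.strict_trans1)
        then show False using r by simp
      qed
      moreover have "\<not> \<gamma> < F r"
      proof
        assume "\<gamma> < F r"
        then have "inf_quantile F \<gamma> \<le> ereal r" unfolding inf_quantile_def by (intro INF_lower) auto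
        then have "ereal y < ereal r" using xy(3) by (rule order.strict_trans2[rotated])
        then show False using r by simp
      qed
      ultimately have "F r = \<gamma>" by simp
      then show False using \<gamma> r by auto
    qed
    then show "inf_quantile F \<gamma> = ereal (quantile F \<gamma>)"
      using sup_quantile_le_inf_quantile[OF \<open>mono F\<close>, of \<gamma>] sup_quantile_eq_quantile[OF F] \<gamma>
      by (metis order.antisym)
  qed
qed

lemma borel_measurable_quantile [measurable]: "quantile F \<in> borel_measurable borel"
proof -
  have "sup_quantile F \<in> borel_measurable borel"
  proof (rule borel_measurableI_greater)
    fix y
    \<comment> \<open>The supremum exceeds \<open>y\<close> exactly if some \<open>z\<close> above
      \<open>y\<close> has \<open>F z\<close> below the level, so superlevel sets are unions of open
      rays.\<close>
    have "{x \<in> space borel. y < sup_quantile F x} = (\<Union>z\<in>{z. y < ereal z}. {F z<..})"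
      by (auto simp: sup_quantile_def less_SUP_iff)
    then show "{x \<in> space borel. y < sup_quantile F x} \<in> sets borel"
      by (metis borel_open open_UN open_greaterThan)
  qed
  then show ?thesis unfolding quantile_def[abs_def] by measurable
qed

section \<open>Right limits and the quantile transform\<close>

lemma Lim_at_right_cdf:
  assumes "F \<in> cdfs"
  shows "Lim (at_right x) F = Inf (F ` {x<..})"
proof -
  have "(F \<longlongrightarrow> Inf (F ` ({x<..} \<inter> UNIV))) (at x within ({x<..} \<inter> UNIV))"
    using assms by (intro Lim_right_bound[where K = 0]) (auto simp: cdf_bounds cdfs_def dest: monoD)
  then show ?thesis by (intro tendsto_Lim) auto
qed

text \<open>The right limit is an infimum, so its lower bounds are the common lower bounds of the
  values to the right. Right limits are handled below through this equivalence.\<close>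

lemma le_Lim_at_right_cdf_iff:
  assumes "F \<in> cdfs"
  shows "\<gamma> \<le> Lim (at_right x) F \<longleftrightarrow> (\<forall>y>x. \<gamma> \<le> F y)"
  unfolding Lim_at_right_cdf[OF assms]
  by (subst le_cInf_iff) (auto simp: cdf_bounds[OF assms] intro!: bdd_belowI[of _ 0])

text \<open>The right-limit function is squeezed by \<open>F x \<le> ?G x \<le> F y\<close> for
  \<open>x < y\<close>. It inherits monotonicity and both limits from \<open>F\<close>, and it is
  right-continuous.\<close>

lemma stieltjes_cdf:
  assumes F: "F \<in> cdfs"
  shows real_distribution_stieltjes: "real_distribution (stieltjes F)"
    and cdf_stieltjes: "cdf (stieltjes F) = (\<lambda>x. Lim (at_right x) F)"
proof -
  let ?G = "\<lambda>x. Lim (at_right x) F"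
  have Fm: "mono F" "(F \<longlongrightarrow> 0) at_bot" "(F \<longlongrightarrow> 1) at_top" using F by (auto simp: cdfs_def)
  note iff = le_Lim_at_right_cdf_iff[OF F]
  \<comment> \<open>Taking \<open>?G x\<close> itself as the level in \<open>iff\<close> turns the
    trivial \<open>?G x \<le> ?G x\<close> into a bound by all values of \<open>F\<close> to the
    right of \<open>x\<close>.\<close>
  have mono: "?G x \<le> ?G y" if "x \<le> y" for x y
    using that iff[of "?G x" x] by (auto simp: iff[of "?G x" y])
  have lower: "F x \<le> ?G x" for x unfolding iff using monoD[OF Fm(1)] by auto
  have upper: "?G x \<le> F y" if "x < y" for x y using iff[of "?G x" x] that by auto
  have cont: "continuous (at_right x) ?G" for x
    unfolding continuous_within
  proof (rule order_tendstoI)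
    fix b assume "b < ?G x"
    then show "\<forall>\<^sub>F y in at_right x. b < ?G y"
      using mono[of x] by (auto simp: eventually_at_right_field intro!: exI[of _ "x + 1"] elim: less_le_trans)
  next
    fix b assume "?G x < b"
    \<comment> \<open>On the interval from \<open>x\<close> to this \<open>y\<close> the right
      limits are at most \<open>F y\<close>, which gives right-continuity.\<close>
    then obtain y where y: "x < y" "F y < b" using iff[of b x] by (metis linorder_not_le)
    then show "\<forall>\<^sub>F y in at_right x. ?G y < b"
      using upper[of _ y] by (auto simp: eventually_at_right_field intro!: exI[of _ y] intro: le_less_trans)
  qed
  have bot: "(?G \<longlongrightarrow> 0) at_bot"
  proof (rule order_tendstoI)
    fix b :: real assume "0 < b"
    then obtain y where "F y < b" using ex_cdf_less[OF F] by auto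
    then show "\<forall>\<^sub>F x in at_bot. ?G x < b"
      using upper[of _ y] by (auto simp: eventually_at_bot_dense intro!: exI[of _ y] intro: le_less_trans)
  next
    fix b :: real assume "b < 0"
    then have "b < ?G x" for x using lower[of x] cdf_bounds(1)[OF F, of x] by linarith
    then show "\<forall>\<^sub>F x in at_bot. b < ?G x" by simp
  qed
  have top: "(?G \<longlongrightarrow> 1) at_top"
  proof (rule tendsto_sandwich[of F])
    have "?G x \<le> 1" for x
      using upper[of x "x + 1"] cdf_bounds(2)[OF F, of "x + 1"] by linarith
    then show "\<forall>\<^sub>F x in at_top. ?G x \<le> 1" by simp
  qed (use lower Fm in auto)
  show "real_distribution (stieltjes F)"
    unfolding stieltjes_def by (rule real_distribution_interval_measure) (fact mono cont bot top)+
  show "cdf (stieltjes F) = ?G"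
    unfolding stieltjes_def by (rule cdf_interval_measure) (fact mono cont bot)+
qed

text \<open>The Galois connection behind the quantile transform: both sides say that no
  \<open>y > x\<close> satisfies \<open>F y < \<gamma>\<close>.\<close>

lemma quantile_le_iff:
  assumes F: "F \<in> cdfs" and \<gamma>: "0 < \<gamma>" "\<gamma> < 1"
  shows "quantile F \<gamma> \<le> x \<longleftrightarrow> \<gamma> \<le> Lim (at_right x) F"
proof -
  have "quantile F \<gamma> \<le> x \<longleftrightarrow> sup_quantile F \<gamma> \<le> ereal x"
    by (simp add: sup_quantile_eq_quantile[OF F \<gamma>])
  also have "\<dots> \<longleftrightarrow> (\<forall>y>x. \<gamma> \<le> F y)"
    by (simp add: sup_quantile_def SUP_le_iff) (metis linorder_not_le)
  finally show ?thesis by (simp add: le_Lim_at_right_cdf_iff[OF F])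
qed

text \<open>Inverse transform sampling: by the Galois connection, the levels in (0, 1) whose
  quantile is at most \<open>x\<close> are those up to the right limit at \<open>x\<close>, and
  their total length is that limit.\<close>

lemma stieltjes_eq_distr:
  assumes F: "F \<in> cdfs"
  shows "stieltjes F = distr (restrict_space lborel {0<..<1}) borel (quantile F)" (is "_ = ?D")
proof (rule cdf_unique)
  let ?\<Omega> = "restrict_space lborel {0<..<1} :: real measure"
  interpret \<Omega>: prob_space ?\<Omega>
    by (auto simp: emeasure_restrict_space space_restrict_space intro!: prob_spaceI)
  have [measurable]: "quantile F \<in> borel_measurable ?\<Omega>"
    by (intro measurable_restrict_space1) simp
  show "real_distribution (stieltjes F)" by (rule real_distribution_stieltjes[OF F])
  then interpret S: real_distribution "stieltjes F" .
  show "real_distribution ?D" by auto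
  have "cdf ?D x = Lim (at_right x) F" (is "_ = ?p") for x
  proof -
    have p: "0 \<le> ?p" "?p \<le> 1"
      using S.cdf_nonneg[of x] S.cdf_bounded_prob[of x] by (simp_all add: cdf_stieltjes[OF F])
    have "cdf ?D x = measure lborel {\<gamma>\<in>{0<..<1}. \<gamma> \<le> ?p}"
      unfolding cdf_def
      by (subst measure_distr)
         (auto simp: quantile_le_iff[OF F] space_restrict_space measure_restrict_space
           intro!: arg_cong2[where f = measure])
    \<comment> \<open>The two sets differ at most in the point \<open>?p\<close>, which is
      null.\<close>
    also have "\<dots> = measure lborel {0<..<?p}"
      unfolding measure_def using p
      by (intro arg_cong[where f = enn2real] emeasure_eq_AE eventually_mono[OF AE_lborel_singleton[of ?p]]) auto
    also have "\<dots> = ?p" using p by simp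
    finally show ?thesis .
  qed
  then show "cdf (stieltjes F) = cdf ?D" by (simp add: cdf_stieltjes[OF F] fun_eq_iff)
qed

text \<open>Positive and negative parts are transported separately along the quantile transform, so
  an infinite value survives.\<close>

lemma ext_integral_stieltjes:
  assumes F: "F \<in> cdfs" and [measurable]: "h \<in> borel_measurable borel" "A \<in> sets borel"
  shows "ext_integral (stieltjes F) A (\<lambda>x. ereal (h x)) =
    ext_integral lborel {\<gamma>\<in>{0<..<1}. quantile F \<gamma> \<in> A} (\<lambda>\<gamma>. ereal (h (quantile F \<gamma>)))"
proof -
  have [measurable]: "quantile F \<in> borel_measurable (restrict_space lborel {0<..<1})"
    by (intro measurable_restrict_space1) simp
  have "(\<integral>\<^sup>+x\<in>A. f x \<partial>stieltjes F) =
      (\<integral>\<^sup>+\<gamma>\<in>{\<gamma>\<in>{0<..<1}. quantile F \<gamma> \<in> A}. f (quantile F \<gamma>) \<partial>lborel)"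
    if [measurable]: "f \<in> borel_measurable borel" for f
    unfolding stieltjes_eq_distr[OF F]
    by (subst nn_integral_distr)
       (auto simp: nn_integral_restrict_space indicator_def intro!: nn_integral_cong)
  then show ?thesis by (simp add: ext_integral_def)
qed

lemma measure_stieltjes:
  assumes F: "F \<in> cdfs" and [measurable]: "A \<in> sets borel"
  shows "measure (stieltjes F) A = measure lborel {\<gamma>\<in>{0<..<1}. quantile F \<gamma> \<in> A}"
proof -
  have [measurable]: "quantile F \<in> borel_measurable (restrict_space lborel {0<..<1})"
    by (intro measurable_restrict_space1) simp
  show ?thesis
    unfolding stieltjes_eq_distr[OF F]
    by (subst measure_distr)
       (auto simp: space_restrict_space measure_restrict_space intro!: arg_cong2[where f = measure])
qed

text \<open>Puts all expectations on one common space of levels, where members of the p-box can be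
  compared pointwise.\<close>

lemma expect_eq_quantile:
  assumes "F \<in> cdfs" "h \<in> borel_measurable borel"
  shows "expect F h = ext_integral lborel {0<..<1} (\<lambda>\<gamma>. ereal (h (quantile F \<gamma>)))"
  using ext_integral_stieltjes[OF assms, of UNIV] by (simp add: expect_def greaterThanLessThan_def Int_def)


section \<open>Integrals between levels\<close>

text \<open>The endpoints are null, and every interior level lies in (0, 1), where the quantile is
  finite. Limits of \<open>h\<close> at infinity thus do not affect the integral.\<close>

lemma ext_integral_sup_quantile:
  assumes "F \<in> cdfs" "0 \<le> c" "d \<le> 1"
  shows "ext_integral lborel {c..d} (\<lambda>\<gamma>. at_ext h (sup_quantile F \<gamma>)) =
    ext_integral lborel {c<..<d} (\<lambda>\<gamma>. ereal (h (quantile F \<gamma>)))"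
proof (rule ext_integral_cong_AE)
  show "AE \<gamma> in lborel. (\<gamma> \<in> {c..d} \<longleftrightarrow> \<gamma> \<in> {c<..<d}) \<and>
      (\<gamma> \<in> {c..d} \<longrightarrow> at_ext h (sup_quantile F \<gamma>) = ereal (h (quantile F \<gamma>)))"
    using AE_lborel_singleton[of c] AE_lborel_singleton[of d]
    by eventually_elim (use assms in \<open>auto simp: sup_quantile_eq_quantile at_ext_def\<close>)
qed

lemma ext_integral_inf_quantile:
  assumes "F \<in> cdfs" "0 \<le> c" "d \<le> 1"
  shows "ext_integral lborel {c..d} (\<lambda>\<gamma>. at_ext h (inf_quantile F \<gamma>)) =
    ext_integral lborel {c<..<d} (\<lambda>\<gamma>. ereal (h (quantile F \<gamma>)))"
proof (rule ext_integral_cong_AE)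
  show "AE \<gamma> in lborel. (\<gamma> \<in> {c..d} \<longleftrightarrow> \<gamma> \<in> {c<..<d}) \<and>
      (\<gamma> \<in> {c..d} \<longrightarrow> at_ext h (inf_quantile F \<gamma>) = ereal (h (quantile F \<gamma>)))"
    using AE_lborel_singleton[of c] AE_lborel_singleton[of d] inf_quantile_eq_quantile_AE[OF assms(1)]
    by eventually_elim (use assms in \<open>auto simp: at_ext_def\<close>)
qed

lemma ext_integral_split_interval:
  fixes f :: "real \<Rightarrow> real"
  assumes [measurable]: "f \<in> borel_measurable borel" and bound: "\<And>x. f x \<le> K"
    and c: "b \<le> c" "c \<le> d"
  shows "ext_integral lborel {b<..<d} (\<lambda>x. ereal (f x)) =
    ext_integral lborel {b<..<c} (\<lambda>x. ereal (f x)) + ext_integral lborel {c<..<d} (\<lambda>x. ereal (f x))"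
proof -
  have "ext_integral lborel {b<..<d} (\<lambda>x. ereal (f x)) =
      ext_integral lborel ({b<..<c} \<union> {c<..<d}) (\<lambda>x. ereal (f x))"
    by (intro ext_integral_cong_AE eventually_mono[OF AE_lborel_singleton[of c]]) (use c in auto)
  also have "\<dots> = ext_integral lborel {b<..<c} (\<lambda>x. ereal (f x)) + ext_integral lborel {c<..<d} (\<lambda>x. ereal (f x))"
  proof (rule ext_integral_Un[where c = K])
    have "emeasure lborel ({b<..<c} \<union> {c<..<d}) \<le> emeasure lborel {b..d}"
      using c by (intro emeasure_mono) auto
    also have "\<dots> < \<infinity>" by (simp add: emeasure_lborel_Icc_eq)
    finally show "emeasure lborel ({b<..<c} \<union> {c<..<d}) < \<infinity>" .
  qed (auto intro: bound)
  finally show ?thesis .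
qed

text \<open>Translates an integral with a split atom into levels. \<open>I\<close> is the target set
  of levels; it consists, up to null sets, of the levels with quantile in \<open>B\<close> and of
  levels with quantile \<open>q\<close>. The latter have the missing mass
  \<open>measure lborel I - measure (stieltjes F) B\<close>, weighted by \<open>h q\<close>.\<close>

lemma ext_integral_stieltjes_atom:
  assumes F: "F \<in> cdfs" and h [measurable]: "h \<in> borel_measurable borel" and bound: "\<And>x. h x \<le> K"
    and [measurable]: "B \<in> sets borel" "I \<in> sets borel" and I: "I \<subseteq> {0<..<1}"
    and B_sub: "AE \<gamma> in lborel. \<gamma> \<in> {0<..<1} \<and> quantile F \<gamma> \<in> B \<longrightarrow> \<gamma> \<in> I"
    and I_sub: "AE \<gamma> in lborel. \<gamma> \<in> I \<longrightarrow> quantile F \<gamma> \<in> B \<or> quantile F \<gamma> = q"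
  shows "ext_integral (stieltjes F) B (\<lambda>x. ereal (h x))
      + ereal (h q) * ereal (measure lborel I - measure (stieltjes F) B) =
    ext_integral lborel I (\<lambda>\<gamma>. ereal (h (quantile F \<gamma>)))" (is "_ = ext_integral _ _ ?f")
proof -
  define J where "J = {\<gamma>\<in>I. quantile F \<gamma> \<in> B}"
  define R where "R = {\<gamma>\<in>I. quantile F \<gamma> \<notin> B}"
  have [measurable]: "J \<in> sets borel" "R \<in> sets borel" unfolding J_def R_def by measurable
  have fin: "emeasure lborel A < \<infinity>" if "A \<subseteq> I" for A
  proof -
    have "emeasure lborel A \<le> emeasure lborel {0..1::real}"
      using that I by (intro emeasure_mono) auto
    also have "\<dots> < \<infinity>" by (simp add: emeasure_lborel_Icc_eq)
    finally show ?thesis .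
  qed
  \<comment> \<open>By \<open>B_sub\<close> almost no level of \<open>B\<close> lies outside
    \<open>I\<close>, so \<open>J\<close> carries the whole integral over \<open>B\<close>.\<close>
  have eq: "AE \<gamma> in lborel. \<gamma> \<in> {\<gamma>\<in>{0<..<1}. quantile F \<gamma> \<in> B} \<longleftrightarrow> \<gamma> \<in> J"
    using B_sub by eventually_elim (use I in \<open>auto simp: J_def\<close>)
  have 1: "ext_integral (stieltjes F) B (\<lambda>x. ereal (h x)) = ext_integral lborel J ?f"
    unfolding ext_integral_stieltjes[OF F h \<open>B \<in> sets borel\<close>]
    by (intro ext_integral_cong_AE eventually_mono[OF eq]) auto
  have 2: "measure (stieltjes F) B = measure lborel J"
    unfolding measure_stieltjes[OF F \<open>B \<in> sets borel\<close>]
    by (intro measure_eq_AE eq) auto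
  have un: "I = J \<union> R" "J \<inter> R = {}" by (auto simp: J_def R_def)
  have 3: "measure lborel I = measure lborel J + measure lborel R"
    unfolding un(1) by (rule measure_Un_AE) (use un fin[of J] fin[of R] in \<open>auto intro!: fmeasurableI\<close>)
  have "ext_integral lborel I ?f = ext_integral lborel J ?f + ext_integral lborel R ?f"
    unfolding un(1) by (rule ext_integral_Un[where c = K]) (use un fin[of I] in \<open>auto intro: bound\<close>)
  also have "ext_integral lborel R ?f = ext_integral lborel R (\<lambda>_. ereal (h q))"
    by (intro ext_integral_cong_AE eventually_mono[OF I_sub]) (auto simp: R_def)
  also have "\<dots> = ereal (h q * measure lborel R)"
    using fin[of R] un by (intro ext_integral_const) auto
  finally show ?thesis by (simp add: 1 2 3)
qed

text \<open>Any \<open>q\<close> between the two quantiles at level \<open>c\<close> works. If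
  \<open>q\<close> is real, a quantile below \<open>q\<close> forces a level below \<open>c\<close>
  by monotonicity of \<open>inf_quantile\<close> (almost everywhere), and levels below
  \<open>c\<close> have quantile at most \<open>q\<close>. If \<open>q\<close> is -\<infinity>, then
  \<open>c = 0\<close>.\<close>

lemma integral_upto_eq_quantile:
  assumes F: "F \<in> cdfs" and h: "h \<in> borel_measurable borel" and bound: "\<And>x. h x \<le> K"
    and c: "0 \<le> c" "c \<le> 1" and q: "sup_quantile F c \<le> q" "q \<le> inf_quantile F c" "q \<noteq> \<infinity>"
  shows "integral_upto F h q c = ext_integral lborel {0<..<c} (\<lambda>\<gamma>. ereal (h (quantile F \<gamma>)))"
proof (cases q)
  case (real x)
  have set: "{y. ereal y < ereal x} = {..<x}" by auto
  have "ext_integral (stieltjes F) {..<x} (\<lambda>x. ereal (h x))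
      + ereal (h x) * ereal (measure lborel {0<..<c} - measure (stieltjes F) {..<x}) =
    ext_integral lborel {0<..<c} (\<lambda>\<gamma>. ereal (h (quantile F \<gamma>)))"
  proof (rule ext_integral_stieltjes_atom[OF F h bound])
    show "AE \<gamma> in lborel. \<gamma> \<in> {0<..<1} \<and> quantile F \<gamma> \<in> {..<x} \<longrightarrow> \<gamma> \<in> {0<..<c}"
      using inf_quantile_eq_quantile_AE[OF F]
    proof (eventually_elim, intro impI)
      fix \<gamma> assume \<gamma>: "0 < \<gamma> \<and> \<gamma> < 1 \<longrightarrow> inf_quantile F \<gamma> = ereal (quantile F \<gamma>)"
        "\<gamma> \<in> {0<..<1} \<and> quantile F \<gamma> \<in> {..<x}"
      have "inf_quantile F \<gamma> < inf_quantile F c"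
        using \<gamma> q(2) by (auto simp: real intro: less_le_trans[of _ "ereal x"])
      then show "\<gamma> \<in> {0<..<c}" using \<gamma> inf_quantile_mono[of c \<gamma> F] by (auto simp: not_le[symmetric])
    qed
    show "AE \<gamma> in lborel. \<gamma> \<in> {0<..<c} \<longrightarrow> quantile F \<gamma> \<in> {..<x} \<or> quantile F \<gamma> = x"
    proof (intro always_eventually allI impI)
      fix \<gamma> assume \<gamma>: "\<gamma> \<in> {0<..<c}"
      have "ereal (quantile F \<gamma>) = sup_quantile F \<gamma>"
        using \<gamma> c by (simp add: sup_quantile_eq_quantile[OF F])
      also have "\<dots> \<le> sup_quantile F c" using \<gamma> by (intro sup_quantile_mono) auto
      also have "\<dots> \<le> ereal x" using q by (simp add: real)
      finally show "quantile F \<gamma> \<in> {..<x} \<or> quantile F \<gamma> = x" by auto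
    qed
  qed (use c in auto)
  then show ?thesis using c unfolding real integral_upto_def set by (simp add: at_ext_def)
next
  case MInf
  have "\<not> 0 < c"
  proof
    assume "0 < c"
    then obtain y where "F y < c" using ex_cdf_less[OF F] by auto
    then have "ereal y \<le> sup_quantile F c" unfolding sup_quantile_def by (intro SUP_upper) auto
    then show False using q by (simp add: MInf)
  qed
  \<comment> \<open>Both domains are empty, and the atom term vanishes because 0 times an infinite
    \<open>ereal\<close> is 0.\<close>
  then show ?thesis using c by (simp add: MInf integral_upto_def ext_integral_def zero_ereal_def[symmetric])
qed (use q in simp)

text \<open>Mirror image: \<open>sup_quantile\<close> now confines the levels with quantile above
  \<open>q\<close>, and \<open>inf_quantile\<close> gives the almost-everywhere bound for levels
  above \<open>c\<close>. The infinite case forces \<open>c = 1\<close>.\<close>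

lemma integral_from_eq_quantile:
  assumes F: "F \<in> cdfs" and h: "h \<in> borel_measurable borel" and bound: "\<And>x. h x \<le> K"
    and c: "0 \<le> c" "c \<le> 1" and q: "sup_quantile F c \<le> q" "q \<le> inf_quantile F c" "q \<noteq> -\<infinity>"
  shows "integral_from F h q c = ext_integral lborel {c<..<1} (\<lambda>\<gamma>. ereal (h (quantile F \<gamma>)))"
proof (cases q)
  case (real x)
  have set: "{y. ereal x < ereal y} = {x<..}" by auto
  have "ext_integral (stieltjes F) {x<..} (\<lambda>x. ereal (h x))
      + ereal (h x) * ereal (measure lborel {c<..<1} - measure (stieltjes F) {x<..}) =
    ext_integral lborel {c<..<1} (\<lambda>\<gamma>. ereal (h (quantile F \<gamma>)))"
  proof (rule ext_integral_stieltjes_atom[OF F h bound])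
    show "AE \<gamma> in lborel. \<gamma> \<in> {0<..<1} \<and> quantile F \<gamma> \<in> {x<..} \<longrightarrow> \<gamma> \<in> {c<..<1}"
    proof (intro always_eventually allI impI)
      fix \<gamma> assume \<gamma>: "\<gamma> \<in> {0<..<1} \<and> quantile F \<gamma> \<in> {x<..}"
      have "sup_quantile F c < sup_quantile F \<gamma>"
        using \<gamma> q(1) by (auto simp: real sup_quantile_eq_quantile[OF F] intro: le_less_trans[of _ "ereal x"])
      then show "\<gamma> \<in> {c<..<1}" using \<gamma> sup_quantile_mono[of \<gamma> c F] by (auto simp: not_le[symmetric])
    qed
    show "AE \<gamma> in lborel. \<gamma> \<in> {c<..<1} \<longrightarrow> quantile F \<gamma> \<in> {x<..} \<or> quantile F \<gamma> = x"
      using inf_quantile_eq_quantile_AE[OF F]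
    proof (eventually_elim, intro impI)
      fix \<gamma> assume \<gamma>: "0 < \<gamma> \<and> \<gamma> < 1 \<longrightarrow> inf_quantile F \<gamma> = ereal (quantile F \<gamma>)"
        "\<gamma> \<in> {c<..<1}"
      have "ereal x \<le> inf_quantile F c" using q by (simp add: real)
      also have "\<dots> \<le> inf_quantile F \<gamma>" using \<gamma> by (intro inf_quantile_mono) auto
      also have "\<dots> = ereal (quantile F \<gamma>)" using \<gamma> c by auto
      finally show "quantile F \<gamma> \<in> {x<..} \<or> quantile F \<gamma> = x" by auto
    qed
  qed (use c in auto)
  then show ?thesis using c unfolding real integral_from_def set by (simp add: at_ext_def)
next
  case PInf
  have "\<not> c < 1"
  proof
    assume "c < 1"
    then obtain y where "c < F y" using ex_cdf_greater[OF F] by auto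
    then have "inf_quantile F c \<le> ereal y" unfolding inf_quantile_def by (intro INF_lower) auto
    then show False using q by (simp add: PInf)
  qed
  then show ?thesis using c by (simp add: PInf integral_from_def ext_integral_def zero_ereal_def[symmetric])
qed (use q in simp)


section \<open>Unimodal functions on a p-box\<close>

text \<open>Monotonicity guarantees that the limit in \<open>at_ext\<close> exists in
  \<open>ereal\<close>, where it may be -\<infinity>.\<close>

lemma at_ext_PInfty:
  assumes "antimono_on {a..} h"
  shows "at_ext h \<infinity> = (INF x\<in>{a..}. ereal (h x))" (is "_ = ?L")
proof -
  have "((\<lambda>x. ereal (h x)) \<longlongrightarrow> ?L) at_top"
  proof (rule order_tendstoI)
    fix b assume "b < ?L"
    then have "b < ereal (h x)" if "a \<le> x" for x
      using that by (auto intro: less_le_trans[OF _ INF_lower])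
    then show "\<forall>\<^sub>F x in at_top. b < ereal (h x)"
      by (auto simp: eventually_at_top_linorder)
  next
    fix b assume "?L < b"
    then obtain x where x: "a \<le> x" "ereal (h x) < b" by (auto simp: INF_less_iff)
    have "ereal (h y) < b" if "x \<le> y" for y
      using monotone_onD[OF assms, of x y] x that by (auto intro: le_less_trans[of _ "ereal (h x)"])
    then show "\<forall>\<^sub>F x in at_top. ereal (h x) < b"
      by (auto simp: eventually_at_top_linorder)
  qed
  then show ?thesis
    unfolding at_ext_def PInfty_eq_infinity[symmetric] ereal.case by (intro tendsto_Lim) auto
qed

lemma at_ext_MInfty:
  assumes "mono_on {..a} h"
  shows "at_ext h (-\<infinity>) = (INF x\<in>{..a}. ereal (h x))" (is "_ = ?L")
proof -
  have "((\<lambda>x. ereal (h x)) \<longlongrightarrow> ?L) at_bot"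
  proof (rule order_tendstoI)
    fix b assume "b < ?L"
    then have "b < ereal (h x)" if "x \<le> a" for x
      using that by (auto intro: less_le_trans[OF _ INF_lower])
    then show "\<forall>\<^sub>F x in at_bot. b < ereal (h x)"
      by (auto simp: eventually_at_bot_linorder)
  next
    fix b assume "?L < b"
    then obtain x where x: "x \<le> a" "ereal (h x) < b" by (auto simp: INF_less_iff)
    have "ereal (h y) < b" if "y \<le> x" for y
      using monotone_onD[OF assms, of y x] x that by (auto intro: le_less_trans[of _ "ereal (h x)"])
    then show "\<forall>\<^sub>F x in at_bot. ereal (h x) < b"
      by (auto simp: eventually_at_bot_linorder)
  qed
  then show ?thesis
    unfolding at_ext_def MInfty_eq_minfinity[symmetric] ereal.case by (intro tendsto_Lim) auto
qed

lemma at_ext_ereal [simp]: "at_ext h (ereal x) = ereal (h x)"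
  by (simp add: at_ext_def)

text \<open>Extends monotonicity of the left branch to -\<infinity>, the value of the left balancing
  quantile when \<open>\<alpha> = 0\<close>.\<close>

lemma at_ext_mono:
  assumes h: "mono_on {..a} h" and le: "p \<le> ereal x" "x \<le> a"
  shows "at_ext h p \<le> ereal (h x)"
proof (cases p)
  case (real y)
  then show ?thesis using monotone_onD[OF h, of y x] le by auto
next
  case MInf
  then show ?thesis using INF_lower[of x "{..a}" "\<lambda>x. ereal (h x)"] le by (simp add: at_ext_MInfty[OF h])
qed (use le in simp)

text \<open>The counterpart on the right branch, where \<infinity> is the balancing quantile when
  \<open>\<alpha> = 1\<close>.\<close>

lemma at_ext_antimono:
  assumes h: "antimono_on {a..} h" and le: "ereal x \<le> p" "a \<le> x"
  shows "at_ext h p \<le> ereal (h x)"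
proof (cases p)
  case (real y)
  then show ?thesis using monotone_onD[OF h, of x y] le by auto
next
  case PInf
  then show ?thesis using INF_lower[of x "{a..}" "\<lambda>x. ereal (h x)"] le by (simp add: at_ext_PInfty[OF h])
qed (use le in simp)

lemma unimodal_le:
  fixes h :: "real \<Rightarrow> real"
  assumes "mono_on {..a} h" "antimono_on {a..} h"
  shows "h x \<le> h a"
  using monotone_onD[OF assms(1), of x a] monotone_onD[OF assms(2), of a x] by (cases "x \<le> a") auto

text \<open>Since \<open>h x = h (min x a) + h (max x a) - h a\<close>, the function is a sum of a
  monotone, an antitone and a constant function.\<close>

lemma unimodal_borel_measurable:
  fixes h :: "real \<Rightarrow> real"
  assumes "mono_on {..a} h" "antimono_on {a..} h"
  shows "h \<in> borel_measurable borel"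
proof -
  have "mono (\<lambda>x. h (min x a))"
    by (intro monoI monotone_onD[OF assms(1)]) auto
  then have [measurable]: "(\<lambda>x. h (min x a)) \<in> borel_measurable borel"
    by (rule borel_measurable_mono)
  have "mono (\<lambda>x. - h (max x a))"
    using monotone_onD[OF assms(2)] by (intro monoI) auto
  then have "(\<lambda>x. - h (max x a)) \<in> borel_measurable borel"
    by (rule borel_measurable_mono)
  then have "(\<lambda>x. h (min x a) - - h (max x a) - h a) \<in> borel_measurable borel"
    by measurable
  also have "(\<lambda>x. h (min x a) - - h (max x a) - h a) = h"
    by (auto simp: fun_eq_iff min_def max_def)
  finally show ?thesis .
qed

section \<open>The upper expectation\<close>

locale unimodal_pbox =
  fixes h Flo Fup :: "real \<Rightarrow> real" and a :: real and \<D> :: "(real \<Rightarrow> real) set"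
  assumes D: "\<D> = sigma_additive_cdfs \<or> \<D> = cdfs"
    and lo_mem: "Flo \<in> \<D>" and up_mem: "Fup \<in> \<D>" and lo_le_up: "Flo x \<le> Fup x"
    and h_mono: "mono_on {..a} h" and h_antimono: "antimono_on {a..} h"
begin

lemma D_subset: "F \<in> \<D> \<Longrightarrow> F \<in> cdfs"
  using D by (auto simp: sigma_additive_cdfs_def)

text \<open>Serves both readings of \<open>\<D>\<close>: right-continuity has to be shown only where
  \<open>Flo\<close> and \<open>Fup\<close> have it, which is everywhere in the \<sigma>-additive
  case.\<close>

lemma D_I:
  assumes "F \<in> cdfs"
    and "\<And>x. (Flo \<longlongrightarrow> Flo x) (at_right x) \<Longrightarrow> (Fup \<longlongrightarrow> Fup x) (at_right x) \<Longrightarrow> (F \<longlongrightarrow> F x) (at_right x)"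
  shows "F \<in> \<D>"
  using D
proof
  assume "\<D> = sigma_additive_cdfs"
  then show ?thesis
    using lo_mem up_mem assms by (auto simp: sigma_additive_cdfs_def continuous_within)
qed (use assms in simp)

lemmas lo_cdf = D_subset[OF lo_mem] and up_cdf = D_subset[OF up_mem]

lemma lo_mono: "mono Flo" and up_mono: "mono Fup"
  using lo_cdf up_cdf by (auto simp: cdfs_def)

lemmas h_le = unimodal_le[OF h_mono h_antimono]
lemmas h_measurable [measurable] = unimodal_borel_measurable[OF h_mono h_antimono]

lemmas expect_quantile = expect_eq_quantile[OF _ h_measurable]

lemma quantile_between:
  assumes F: "F \<in> pbox \<D> Flo Fup" and \<gamma>: "0 < \<gamma>" "\<gamma> < 1"
  shows "quantile Fup \<gamma> \<le> quantile F \<gamma>" "quantile F \<gamma> \<le> quantile Flo \<gamma>"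
proof -
  have F': "F \<in> cdfs" and le: "Flo x \<le> F x" "F x \<le> Fup x" for x
    using F D_subset by (auto simp: pbox_def)
  have "sup_quantile Fup \<gamma> \<le> sup_quantile F \<gamma>" "sup_quantile F \<gamma> \<le> sup_quantile Flo \<gamma>"
    by (intro sup_quantile_antimono le)+
  then show "quantile Fup \<gamma> \<le> quantile F \<gamma>" "quantile F \<gamma> \<le> quantile Flo \<gamma>"
    using F' lo_cdf up_cdf \<gamma> by (simp_all add: sup_quantile_eq_quantile)
qed

lemma split_level:
  assumes "b \<le> c" "c \<le> d"
  shows "ext_integral lborel {b<..<d} (\<lambda>\<gamma>. ereal (h (quantile F \<gamma>))) =
    ext_integral lborel {b<..<c} (\<lambda>\<gamma>. ereal (h (quantile F \<gamma>)))
    + ext_integral lborel {c<..<d} (\<lambda>\<gamma>. ereal (h (quantile F \<gamma>)))"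
  by (rule ext_integral_split_interval) (use assms in \<open>auto intro: h_le\<close>)

text \<open>The largest expectation is that of the distribution moving as much mass as possible to \<open>a\<close>.\<close>

definition Fmax :: "real \<Rightarrow> real" where
  "Fmax x = (if x < a then Flo x else Fup x)"

text \<open>The switch at \<open>a\<close> preserves monotonicity because
  \<open>Flo \<le> Fup\<close>. Taking the value \<open>Fup a\<close> at \<open>a\<close> itself
  keeps right-continuity there.\<close>

lemma Fmax_pbox: "Fmax \<in> pbox \<D> Flo Fup"
proof -
  have "mono Fmax"
  proof (rule monoI)
    fix x y :: real assume "x \<le> y"
    then show "Fmax x \<le> Fmax y"
      using monoD[OF lo_mono, of x y] monoD[OF up_mono, of x y] lo_le_up[of y] by (auto simp: Fmax_def)
  qed
  moreover have "(Fmax \<longlongrightarrow> 0) at_bot"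
  proof (rule Lim_transform_eventually)
    show "(Flo \<longlongrightarrow> 0) at_bot" using lo_cdf by (simp add: cdfs_def)
    show "\<forall>\<^sub>F x in at_bot. Flo x = Fmax x"
      by (auto simp: eventually_at_bot_dense Fmax_def intro!: exI[of _ a])
  qed
  moreover have "(Fmax \<longlongrightarrow> 1) at_top"
  proof (rule Lim_transform_eventually)
    show "(Fup \<longlongrightarrow> 1) at_top" using up_cdf by (simp add: cdfs_def)
    show "\<forall>\<^sub>F x in at_top. Fup x = Fmax x"
      by (auto simp: eventually_at_top_linorder Fmax_def intro!: exI[of _ a])
  qed
  ultimately have "Fmax \<in> cdfs" by (simp add: cdfs_def)
  then have "Fmax \<in> \<D>"
  proof (rule D_I)
    fix x assume lim: "(Flo \<longlongrightarrow> Flo x) (at_right x)" "(Fup \<longlongrightarrow> Fup x) (at_right x)"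
    show "(Fmax \<longlongrightarrow> Fmax x) (at_right x)"
    proof (cases "x < a")
      case True
      then have "\<forall>\<^sub>F y in at_right x. Flo y = Fmax y"
        by (auto simp: eventually_at_right_field Fmax_def intro!: exI[of _ a])
      from Lim_transform_eventually[OF lim(1) this] True show ?thesis by (simp add: Fmax_def[of x])
    next
      case False
      then have "\<forall>\<^sub>F y in at_right x. Fup y = Fmax y"
        by (auto simp: eventually_at_right_field Fmax_def intro!: exI[of _ "x + 1"])
      from Lim_transform_eventually[OF lim(2) this] False show ?thesis by (simp add: Fmax_def[of x])
    qed
  qed
  then show ?thesis using lo_le_up by (auto simp: pbox_def Fmax_def)
qed

text \<open>Below level \<open>Flo a\<close>, \<open>Fmax\<close> and \<open>Flo\<close> exceed
  \<gamma> at the same points, so their \<open>inf_quantile\<close> agree; above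
  \<open>Fup a\<close>, \<open>Fmax\<close> and \<open>Fup\<close> are below \<gamma> at the same
  points, so their \<open>sup_quantile\<close> agree. Levels in between are jumped over at
  \<open>a\<close>. Mixing the two quantiles is harmless almost everywhere.\<close>

lemma quantile_Fmax:
  "AE \<gamma> in lborel. \<gamma> \<in> {0<..<1} \<longrightarrow>
    (\<gamma> < Flo a \<longrightarrow> quantile Fmax \<gamma> = quantile Flo \<gamma> \<and> quantile Flo \<gamma> \<le> a) \<and>
    (Flo a < \<gamma> \<and> \<gamma> < Fup a \<longrightarrow> quantile Fmax \<gamma> = a) \<and>
    (Fup a < \<gamma> \<longrightarrow> quantile Fmax \<gamma> = quantile Fup \<gamma> \<and> a \<le> quantile Fup \<gamma>)"
proof -
  have Fmax: "Fmax \<in> cdfs" using Fmax_pbox D_subset by (auto simp: pbox_def)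
  then have mono: "mono Fmax" by (simp add: cdfs_def)
  show ?thesis
    using inf_quantile_eq_quantile_AE[OF Fmax] inf_quantile_eq_quantile_AE[OF lo_cdf]
      inf_quantile_eq_quantile_AE[OF up_cdf]
  proof (eventually_elim, intro impI conjI)
    fix \<gamma>
    assume "\<gamma> \<in> {0<..<1}"
      and "0 < \<gamma> \<and> \<gamma> < 1 \<longrightarrow> inf_quantile Fmax \<gamma> = ereal (quantile Fmax \<gamma>)"
      and "0 < \<gamma> \<and> \<gamma> < 1 \<longrightarrow> inf_quantile Flo \<gamma> = ereal (quantile Flo \<gamma>)"
      and "0 < \<gamma> \<and> \<gamma> < 1 \<longrightarrow> inf_quantile Fup \<gamma> = ereal (quantile Fup \<gamma>)"
    then have inf: "inf_quantile Fmax \<gamma> = ereal (quantile Fmax \<gamma>)"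
        "inf_quantile Flo \<gamma> = ereal (quantile Flo \<gamma>)" "inf_quantile Fup \<gamma> = ereal (quantile Fup \<gamma>)"
      and sup: "sup_quantile Fmax \<gamma> = ereal (quantile Fmax \<gamma>)"
        "sup_quantile Flo \<gamma> = ereal (quantile Flo \<gamma>)" "sup_quantile Fup \<gamma> = ereal (quantile Fup \<gamma>)"
      by (auto simp: sup_quantile_eq_quantile Fmax lo_cdf up_cdf)
    {
      assume \<gamma>: "\<gamma> < Flo a"
      have "\<gamma> < Fup x" "\<gamma> < Flo x" if "a \<le> x" for x
        using \<gamma> lo_le_up[of x] monoD[OF lo_mono that] by auto
      then have "{x. \<gamma> < Fmax x} = {x. \<gamma> < Flo x}" by (auto simp: Fmax_def not_less)
      then have "inf_quantile Fmax \<gamma> = inf_quantile Flo \<gamma>" by (simp add: inf_quantile_def)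
      then show "quantile Fmax \<gamma> = quantile Flo \<gamma>" by (simp add: inf)
      show "quantile Flo \<gamma> \<le> a"
        using sup_quantile_mono[of \<gamma> "Flo a" Flo] sup_quantile_le_cdf[OF lo_mono, of a] \<gamma> sup(2)
        by (metis ereal_less_eq(3) less_imp_le order.trans)
    }
    {
      assume \<gamma>: "Fup a < \<gamma>"
      have "Fup x < \<gamma>" "Flo x < \<gamma>" if "x \<le> a" for x
        using \<gamma> lo_le_up[of x] monoD[OF up_mono that] by auto
      then have "{x. Fmax x < \<gamma>} = {x. Fup x < \<gamma>}" by (auto simp: Fmax_def)
      then have "sup_quantile Fmax \<gamma> = sup_quantile Fup \<gamma>" by (simp add: sup_quantile_def)
      then show "quantile Fmax \<gamma> = quantile Fup \<gamma>" by (simp add: sup)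
      show "a \<le> quantile Fup \<gamma>"
        using inf_quantile_mono[of "Fup a" \<gamma> Fup] inf_quantile_ge_cdf[OF up_mono, of a] \<gamma> inf(3)
        by (metis ereal_less_eq(3) less_imp_le order.trans)
    }
    {
      assume \<gamma>: "Flo a < \<gamma> \<and> \<gamma> < Fup a"
      have "a \<le> x" if "\<gamma> < Fmax x" for x
        using \<gamma> that monoD[OF lo_mono, of x a] by (cases "x < a") (auto simp: Fmax_def)
      then have "ereal a \<le> inf_quantile Fmax \<gamma>"
        unfolding inf_quantile_def by (intro INF_greatest) auto
      moreover have "inf_quantile Fmax \<gamma> \<le> ereal a"
        unfolding inf_quantile_def using \<gamma> by (intro INF_lower) (auto simp: Fmax_def)
      ultimately show "quantile Fmax \<gamma> = a" by (simp add: inf)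
    }
  qed
qed

text \<open>Low levels use the rightmost admissible quantile, still on the increasing branch, and
  high levels the leftmost one, on the decreasing branch. Levels in between attain
  \<open>h a\<close>.\<close>

lemma upper_expect_eq_Fmax: "upper_expect \<D> Flo Fup h = expect Fmax h"
  unfolding upper_expect_def
proof (rule antisym[OF SUP_least SUP_upper[OF Fmax_pbox]])
  fix F assume F: "F \<in> pbox \<D> Flo Fup"
  have cdfs: "F \<in> cdfs" "Fmax \<in> cdfs" using F Fmax_pbox D_subset by (auto simp: pbox_def)
  show "expect F h \<le> expect Fmax h"
    unfolding expect_quantile[OF cdfs(1)] expect_quantile[OF cdfs(2)]
  proof (rule ext_integral_mono_AE)
    show "AE \<gamma> in lborel. \<gamma> \<in> {0<..<1} \<longrightarrow> ereal (h (quantile F \<gamma>)) \<le> ereal (h (quantile Fmax \<gamma>))"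
      using quantile_Fmax AE_lborel_singleton[of "Flo a"] AE_lborel_singleton[of "Fup a"]
    proof (eventually_elim, intro impI)
      fix \<gamma> assume q: "\<gamma> \<in> {0<..<1} \<longrightarrow>
          (\<gamma> < Flo a \<longrightarrow> quantile Fmax \<gamma> = quantile Flo \<gamma> \<and> quantile Flo \<gamma> \<le> a) \<and>
          (Flo a < \<gamma> \<and> \<gamma> < Fup a \<longrightarrow> quantile Fmax \<gamma> = a) \<and>
          (Fup a < \<gamma> \<longrightarrow> quantile Fmax \<gamma> = quantile Fup \<gamma> \<and> a \<le> quantile Fup \<gamma>)"
        and ne: "\<gamma> \<noteq> Flo a" "\<gamma> \<noteq> Fup a" and \<gamma>: "\<gamma> \<in> {0<..<1}"
      consider "\<gamma> < Flo a" | "Flo a < \<gamma>" "\<gamma> < Fup a" | "Fup a < \<gamma>" using ne by linarith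
      then show "ereal (h (quantile F \<gamma>)) \<le> ereal (h (quantile Fmax \<gamma>))"
      proof cases
        case 1
        then show ?thesis using q \<gamma> quantile_between[OF F, of \<gamma>] by (auto intro!: monotone_onD[OF h_mono])
      next
        case 2
        then show ?thesis using q \<gamma> h_le by auto
      next
        case 3
        then show ?thesis using q \<gamma> quantile_between[OF F, of \<gamma>]
          using monotone_onD[OF h_antimono, of "quantile Fup \<gamma>" "quantile F \<gamma>"] by auto
      qed
    qed
  qed
qed

lemma upper_expect_eq:
  "upper_expect \<D> Flo Fup h =
    ext_integral lborel {0<..<Flo a} (\<lambda>\<gamma>. ereal (h (quantile Flo \<gamma>)))
    + ereal (h a * (Fup a - Flo a))
    + ext_integral lborel {Fup a<..<1} (\<lambda>\<gamma>. ereal (h (quantile Fup \<gamma>)))"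
proof -
  have cdf: "Fmax \<in> cdfs" using Fmax_pbox D_subset by (auto simp: pbox_def)
  note le = cdf_bounds[OF lo_cdf, of a] cdf_bounds[OF up_cdf, of a] lo_le_up[of a]
  let ?f = "\<lambda>\<gamma>. ereal (h (quantile Fmax \<gamma>))"
  have "upper_expect \<D> Flo Fup h =
      ext_integral lborel {0<..<Flo a} ?f + ext_integral lborel {Flo a<..<1} ?f"
    unfolding upper_expect_eq_Fmax expect_quantile[OF cdf] using le by (intro split_level) auto
  also have "ext_integral lborel {Flo a<..<1} ?f =
      ext_integral lborel {Flo a<..<Fup a} ?f + ext_integral lborel {Fup a<..<1} ?f"
    using le by (intro split_level) auto
  also have "ext_integral lborel {0<..<Flo a} ?f =
      ext_integral lborel {0<..<Flo a} (\<lambda>\<gamma>. ereal (h (quantile Flo \<gamma>)))"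
    by (rule ext_integral_cong_AE, rule eventually_mono[OF quantile_Fmax]) (use le in auto)
  also have "ext_integral lborel {Fup a<..<1} ?f =
      ext_integral lborel {Fup a<..<1} (\<lambda>\<gamma>. ereal (h (quantile Fup \<gamma>)))"
    by (rule ext_integral_cong_AE, rule eventually_mono[OF quantile_Fmax]) (use le in auto)
  also have "ext_integral lborel {Flo a<..<Fup a} ?f = ext_integral lborel {Flo a<..<Fup a} (\<lambda>_. ereal (h a))"
    by (rule ext_integral_cong_AE, rule eventually_mono[OF quantile_Fmax]) (use le in auto)
  also have "\<dots> = ereal (h a * (Fup a - Flo a))"
    using le by (subst ext_integral_const) auto
  finally show ?thesis by (simp add: add.assoc)
qed

end

section \<open>The lower expectation\<close>

text \<open>The smallest expectation is that of the distribution moving as much mass as possible away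
  from \<open>a\<close>: a share \<open>\<alpha>\<close> to the left and the rest to the right.\<close>

locale unimodal_pbox_level = unimodal_pbox +
  fixes \<alpha> :: real
  assumes level: "Flo a \<le> \<alpha>" "\<alpha> \<le> Fup a"
    and balance: "at_ext h (sup_quantile Fup \<alpha>) = at_ext h (inf_quantile Flo \<alpha>)"
begin

text \<open>This is \<alpha> clamped to the p-box: \<open>Fup\<close> until it reaches \<alpha>,
  then constant, then \<open>Flo\<close> once it exceeds \<alpha>. The lattice form passes on
  monotonicity and right-continuity without a case split.\<close>

definition Fmin :: "real \<Rightarrow> real" where
  "Fmin x = max (Flo x) (min (Fup x) \<alpha>)"

lemma level_01: "0 \<le> \<alpha>" "\<alpha> \<le> 1"
  using level cdf_bounds[OF lo_cdf, of a] cdf_bounds[OF up_cdf, of a] by auto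

text \<open>Together with the next lemma this puts the two balancing quantiles on opposite sides of
  \<open>a\<close>, one on each branch of \<open>h\<close>.\<close>

lemma sup_quantile_le_a: "sup_quantile Fup \<alpha> \<le> ereal a"
  using sup_quantile_mono[OF level(2)] sup_quantile_le_cdf[OF up_mono] by (rule order.trans)

lemma inf_quantile_ge_a: "ereal a \<le> inf_quantile Flo \<alpha>"
  using inf_quantile_ge_cdf[OF lo_mono] inf_quantile_mono[OF level(1)] by (rule order.trans)

lemma Fmin_pbox: "Fmin \<in> pbox \<D> Flo Fup"
proof -
  have "mono Fmin"
    unfolding Fmin_def by (intro monoI max.mono min.mono monoD[OF lo_mono] monoD[OF up_mono]) auto
  moreover have "(Fmin \<longlongrightarrow> max 0 (min 0 \<alpha>)) at_bot" "(Fmin \<longlongrightarrow> max 1 (min 1 \<alpha>)) at_top"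
    unfolding Fmin_def using lo_cdf up_cdf
    by (intro tendsto_max tendsto_min tendsto_const; simp add: cdfs_def)+
  ultimately have "Fmin \<in> cdfs"
    using level_01 by (simp add: cdfs_def)
  then have "Fmin \<in> \<D>"
    by (rule D_I) (auto simp: Fmin_def[abs_def] intro!: tendsto_max tendsto_min)
  then show ?thesis using lo_le_up by (auto simp: pbox_def Fmin_def)
qed

text \<open>The clamp is invisible away from \<alpha>: \<open>Fmin x < \<gamma>\<close> agrees with
  \<open>Fup x < \<gamma>\<close> for \<open>\<gamma> < \<alpha>\<close>, and
  \<open>\<gamma> < Fmin x\<close> with \<open>\<gamma> < Flo x\<close> for
  \<open>\<alpha> < \<gamma>\<close>.\<close>

lemma quantile_Fmin:
  "AE \<gamma> in lborel. \<gamma> \<in> {0<..<1} \<longrightarrow>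
    (\<gamma> < \<alpha> \<longrightarrow> quantile Fmin \<gamma> = quantile Fup \<gamma>) \<and>
    (\<alpha> < \<gamma> \<longrightarrow> quantile Fmin \<gamma> = quantile Flo \<gamma>)"
proof -
  have Fmin: "Fmin \<in> cdfs" using Fmin_pbox D_subset by (auto simp: pbox_def)
  show ?thesis
    using inf_quantile_eq_quantile_AE[OF Fmin] inf_quantile_eq_quantile_AE[OF lo_cdf]
  proof (eventually_elim, intro impI conjI)
    fix \<gamma> assume \<gamma>: "\<gamma> \<in> {0<..<1}"
      and inf: "0 < \<gamma> \<and> \<gamma> < 1 \<longrightarrow> inf_quantile Fmin \<gamma> = ereal (quantile Fmin \<gamma>)"
        "0 < \<gamma> \<and> \<gamma> < 1 \<longrightarrow> inf_quantile Flo \<gamma> = ereal (quantile Flo \<gamma>)"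
    {
      assume "\<gamma> < \<alpha>"
      then have "{x. Fmin x < \<gamma>} = {x. Fup x < \<gamma>}"
        using lo_le_up by (auto simp: Fmin_def intro: le_less_trans)
      then have "sup_quantile Fmin \<gamma> = sup_quantile Fup \<gamma>" by (simp add: sup_quantile_def)
      then show "quantile Fmin \<gamma> = quantile Fup \<gamma>" by (simp add: quantile_def)
    }
    {
      assume "\<alpha> < \<gamma>"
      then have "{x. \<gamma> < Fmin x} = {x. \<gamma> < Flo x}"
        by (auto simp: Fmin_def)
      then have "inf_quantile Fmin \<gamma> = inf_quantile Flo \<gamma>" by (simp add: inf_quantile_def)
      then show "quantile Fmin \<gamma> = quantile Flo \<gamma>" using inf \<gamma> by simp
    }
  qed
qed

text \<open>At each level the chosen end must not exceed \<open>h\<close> at the quantile of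
  \<open>F\<close>. On the same side of \<open>a\<close> this is monotonicity; across
  \<open>a\<close> the comparison passes through the common value in \<open>balance\<close>.\<close>

lemma lower_expect_eq_Fmin: "lower_expect \<D> Flo Fup h = expect Fmin h"
  unfolding lower_expect_def
proof (rule antisym[OF INF_lower[OF Fmin_pbox] INF_greatest])
  fix F assume F: "F \<in> pbox \<D> Flo Fup"
  have cdfs: "F \<in> cdfs" "Fmin \<in> cdfs" using F Fmin_pbox D_subset by (auto simp: pbox_def)
  show "expect Fmin h \<le> expect F h"
    unfolding expect_quantile[OF cdfs(1)] expect_quantile[OF cdfs(2)]
  proof (rule ext_integral_mono_AE)
    show "AE \<gamma> in lborel. \<gamma> \<in> {0<..<1} \<longrightarrow> ereal (h (quantile Fmin \<gamma>)) \<le> ereal (h (quantile F \<gamma>))"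
      using quantile_Fmin AE_lborel_singleton[of \<alpha>] inf_quantile_eq_quantile_AE[OF lo_cdf]
    proof (eventually_elim, intro impI)
      fix \<gamma>
      assume q: "\<gamma> \<in> {0<..<1} \<longrightarrow> (\<gamma> < \<alpha> \<longrightarrow> quantile Fmin \<gamma> = quantile Fup \<gamma>) \<and>
          (\<alpha> < \<gamma> \<longrightarrow> quantile Fmin \<gamma> = quantile Flo \<gamma>)"
        and "\<gamma> \<noteq> \<alpha>" and \<gamma>: "\<gamma> \<in> {0<..<1}"
        and inf: "0 < \<gamma> \<and> \<gamma> < 1 \<longrightarrow> inf_quantile Flo \<gamma> = ereal (quantile Flo \<gamma>)"
      have sup: "sup_quantile Flo \<gamma> = ereal (quantile Flo \<gamma>)" "sup_quantile Fup \<gamma> = ereal (quantile Fup \<gamma>)"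
        using \<gamma> by (auto simp: sup_quantile_eq_quantile lo_cdf up_cdf)
      have between: "quantile Fup \<gamma> \<le> quantile F \<gamma>" "quantile F \<gamma> \<le> quantile Flo \<gamma>"
        using quantile_between[OF F] \<gamma> by auto
      consider "\<gamma> < \<alpha>" | "\<alpha> < \<gamma>" using \<open>\<gamma> \<noteq> \<alpha>\<close> by linarith
      then show "ereal (h (quantile Fmin \<gamma>)) \<le> ereal (h (quantile F \<gamma>))"
      proof cases
        case 1
        then have l: "ereal (quantile Fup \<gamma>) \<le> sup_quantile Fup \<alpha>"
          and u: "ereal (quantile Flo \<gamma>) \<le> inf_quantile Flo \<alpha>"
          using sup inf \<gamma> sup_quantile_mono[of \<gamma> \<alpha> Fup] inf_quantile_mono[of \<gamma> \<alpha> Flo] by auto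
        show ?thesis
        proof (cases "quantile F \<gamma> \<le> a")
          case True
          then show ?thesis using q \<gamma> 1 between monotone_onD[OF h_mono, of "quantile Fup \<gamma>" "quantile F \<gamma>"]
            by auto
        next
          case False
          \<comment> \<open>Crossing from left to right: climb to the left balancing quantile,
            switch to the right one, and climb towards \<open>a\<close>, since
            \<open>quantile F \<gamma>\<close> lies between \<open>a\<close> and
            \<open>inf_quantile Flo \<alpha>\<close>.\<close>
          have "ereal (h (quantile Fup \<gamma>)) \<le> at_ext h (sup_quantile Fup \<alpha>)"
            using l sup_quantile_le_a
            by (cases "sup_quantile Fup \<alpha>") (auto intro: monotone_onD[OF h_mono])
          also have "\<dots> = at_ext h (inf_quantile Flo \<alpha>)" by (rule balance)
          also have "\<dots> \<le> ereal (h (quantile F \<gamma>))"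
            using False between(2) u
            by (intro at_ext_antimono[OF h_antimono] order.trans[OF _ u]) auto
          finally show ?thesis using q \<gamma> 1 by simp
        qed
      next
        case 2
        then have l: "sup_quantile Fup \<alpha> \<le> ereal (quantile Fup \<gamma>)"
          and u: "inf_quantile Flo \<alpha> \<le> ereal (quantile Flo \<gamma>)"
          using sup inf \<gamma> sup_quantile_mono[of \<alpha> \<gamma> Fup] inf_quantile_mono[of \<alpha> \<gamma> Flo] by auto
        show ?thesis
        proof (cases "a \<le> quantile F \<gamma>")
          case True
          then show ?thesis using q \<gamma> 2 between monotone_onD[OF h_antimono, of "quantile F \<gamma>" "quantile Flo \<gamma>"]
            by auto
        next
          case False
          \<comment> \<open>The crossing in the opposite direction. The balancing quantile is finite
            here, being caught between \<open>a\<close> and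
            \<open>quantile Flo \<gamma>\<close>.\<close>
          have "ereal (h (quantile Flo \<gamma>)) \<le> at_ext h (inf_quantile Flo \<alpha>)"
          proof (cases "inf_quantile Flo \<alpha>")
            case (real x)
            then show ?thesis
              using u inf_quantile_ge_a monotone_onD[OF h_antimono, of x "quantile Flo \<gamma>"] by auto
          qed (use u inf_quantile_ge_a in auto)
          also have "\<dots> = at_ext h (sup_quantile Fup \<alpha>)" by (rule balance[symmetric])
          also have "\<dots> \<le> ereal (h (quantile F \<gamma>))"
            using False between(1) l
            by (intro at_ext_mono[OF h_mono] order.trans[OF l]) auto
          finally show ?thesis using q \<gamma> 2 by simp
        qed
      qed
    qed
  qed
qed

lemma lower_expect_eq:
  "lower_expect \<D> Flo Fup h =
    ext_integral lborel {0<..<\<alpha>} (\<lambda>\<gamma>. ereal (h (quantile Fup \<gamma>)))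
    + ext_integral lborel {\<alpha><..<1} (\<lambda>\<gamma>. ereal (h (quantile Flo \<gamma>)))"
proof -
  have cdf: "Fmin \<in> cdfs" using Fmin_pbox D_subset by (auto simp: pbox_def)
  let ?f = "\<lambda>\<gamma>. ereal (h (quantile Fmin \<gamma>))"
  have "lower_expect \<D> Flo Fup h =
      ext_integral lborel {0<..<\<alpha>} ?f + ext_integral lborel {\<alpha><..<1} ?f"
    unfolding lower_expect_eq_Fmin expect_quantile[OF cdf] using level_01 by (intro split_level) auto
  also have "ext_integral lborel {0<..<\<alpha>} ?f =
      ext_integral lborel {0<..<\<alpha>} (\<lambda>\<gamma>. ereal (h (quantile Fup \<gamma>)))"
    by (rule ext_integral_cong_AE, rule eventually_mono[OF quantile_Fmin]) (use level_01 in auto)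
  also have "ext_integral lborel {\<alpha><..<1} ?f =
      ext_integral lborel {\<alpha><..<1} (\<lambda>\<gamma>. ereal (h (quantile Flo \<gamma>)))"
    by (rule ext_integral_cong_AE, rule eventually_mono[OF quantile_Fmin]) (use level_01 in auto)
  finally show ?thesis .
qed

end

text \<open>Both forms of each formula are reduced to the same integrals of quantiles over levels.
  Any balancing level in the range gives the lower expectation, so several such levels yield the
  same value.\<close>

theorem proposition3:
  fixes h Flo Fup :: "real \<Rightarrow> real" and a :: real and \<D> :: "(real \<Rightarrow> real) set"
  assumes "\<D> = sigma_additive_cdfs \<or> \<D> = cdfs \<and> continuous_on UNIV h"
    and "Flo \<in> \<D>" and "Fup \<in> \<D>" and "\<forall>x. Flo x \<le> Fup x"
    and "mono_on {..a} h" and "antimono_on {a..} h"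
  shows
    "upper_expect \<D> Flo Fup h =
       integral_upto Flo h (ereal a) (Flo a)
       + ereal (h a * (Fup a - Flo a))
       + integral_from Fup h (ereal a) (Fup a)
     \<and>
     upper_expect \<D> Flo Fup h =
       ext_integral lborel {0..Flo a} (\<lambda>\<gamma>. at_ext h (inf_quantile Flo \<gamma>))
       + ereal ((Fup a - Flo a) * h a)
       + ext_integral lborel {Fup a..1} (\<lambda>\<gamma>. at_ext h (sup_quantile Fup \<gamma>))
     \<and>
     (\<forall>\<alpha>\<in>{Flo a..Fup a}.
        at_ext h (sup_quantile Fup \<alpha>) = at_ext h (inf_quantile Flo \<alpha>) \<longrightarrow>
        lower_expect \<D> Flo Fup h =
          integral_upto Fup h (sup_quantile Fup \<alpha>) \<alpha>
          + integral_from Flo h (inf_quantile Flo \<alpha>) \<alpha>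
        \<and>
        lower_expect \<D> Flo Fup h =
          ext_integral lborel {0..\<alpha>} (\<lambda>\<gamma>. at_ext h (sup_quantile Fup \<gamma>))
          + ext_integral lborel {\<alpha>..1} (\<lambda>\<gamma>. at_ext h (inf_quantile Flo \<gamma>)))"
proof -
  interpret unimodal_pbox h Flo Fup a \<D>
    by unfold_locales (use assms in auto)
  note bounds = cdf_bounds[OF lo_cdf] cdf_bounds[OF up_cdf]
  \<comment> \<open>The point \<open>a\<close> lies between the two quantiles of \<open>Flo\<close>
    at level \<open>Flo a\<close>, and of \<open>Fup\<close> at level \<open>Fup a\<close>, as the
    atom splitting demands.\<close>
  have upper: "integral_upto Flo h (ereal a) (Flo a) = ext_integral lborel {0<..<Flo a} (\<lambda>\<gamma>. ereal (h (quantile Flo \<gamma>)))"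
    "integral_from Fup h (ereal a) (Fup a) = ext_integral lborel {Fup a<..<1} (\<lambda>\<gamma>. ereal (h (quantile Fup \<gamma>)))"
    by (intro integral_upto_eq_quantile[where K = "h a"] integral_from_eq_quantile[where K = "h a"]
        lo_cdf up_cdf h_measurable h_le bounds sup_quantile_le_cdf inf_quantile_ge_cdf lo_mono up_mono; simp)+
  have lower: "lower_expect \<D> Flo Fup h =
        integral_upto Fup h (sup_quantile Fup \<alpha>) \<alpha> + integral_from Flo h (inf_quantile Flo \<alpha>) \<alpha> \<and>
      lower_expect \<D> Flo Fup h =
        ext_integral lborel {0..\<alpha>} (\<lambda>\<gamma>. at_ext h (sup_quantile Fup \<gamma>))
        + ext_integral lborel {\<alpha>..1} (\<lambda>\<gamma>. at_ext h (inf_quantile Flo \<gamma>))"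
    if "\<alpha> \<in> {Flo a..Fup a}" "at_ext h (sup_quantile Fup \<alpha>) = at_ext h (inf_quantile Flo \<alpha>)" for \<alpha>
  proof -
    interpret unimodal_pbox_level h Flo Fup a \<D> \<alpha>
      by unfold_locales (use that in auto)
    \<comment> \<open>The split point is itself an end of the admissible range of quantiles, and it
      is not \<infinity> because it is at most \<open>a\<close>.\<close>
    have "integral_upto Fup h (sup_quantile Fup \<alpha>) \<alpha> =
        ext_integral lborel {0<..<\<alpha>} (\<lambda>\<gamma>. ereal (h (quantile Fup \<gamma>)))"
      by (rule integral_upto_eq_quantile[OF up_cdf h_measurable h_le level_01 order_refl
            sup_quantile_le_inf_quantile[OF up_mono]]) (use sup_quantile_le_a in auto)
    moreover have "integral_from Flo h (inf_quantile Flo \<alpha>) \<alpha> =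
        ext_integral lborel {\<alpha><..<1} (\<lambda>\<gamma>. ereal (h (quantile Flo \<gamma>)))"
      by (rule integral_from_eq_quantile[OF lo_cdf h_measurable h_le level_01
            sup_quantile_le_inf_quantile[OF lo_mono] order_refl]) (use inf_quantile_ge_a in auto)
    ultimately show ?thesis
      using level_01 by (simp add: lower_expect_eq ext_integral_sup_quantile[OF up_cdf]
          ext_integral_inf_quantile[OF lo_cdf])
  qed
  show ?thesis
  proof (intro conjI ballI impI)
    show "upper_expect \<D> Flo Fup h =
        integral_upto Flo h (ereal a) (Flo a) + ereal (h a * (Fup a - Flo a))
        + integral_from Fup h (ereal a) (Fup a)"
      by (simp add: upper_expect_eq upper)
    show "upper_expect \<D> Flo Fup h =
        ext_integral lborel {0..Flo a} (\<lambda>\<gamma>. at_ext h (inf_quantile Flo \<gamma>))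
        + ereal ((Fup a - Flo a) * h a)
        + ext_integral lborel {Fup a..1} (\<lambda>\<gamma>. at_ext h (sup_quantile Fup \<gamma>))"
      by (simp add: upper_expect_eq mult.commute[of "h a"] bounds
          ext_integral_inf_quantile[OF lo_cdf] ext_integral_sup_quantile[OF up_cdf])
  qed (use lower in blast)+
qed

end
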